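(* Let $(T_i)_{i=1}^{\infty}$ be an almost-commuting, submultiplicative sequence of bounded linear operators on a Banach space $X$. Then the following assertions are equivalent: (1) $(T_i)_{i}$ has a mean Li-Yorke pair; (2) $(T_i)_{i}$ has an absolutely mean semi-irregular vector; (3) $(T_i)_{i}$ is mean Li-Yorke chaotic; (4) $(T_i)_{i}$ has an absolutely mean irregular vector; (5) there exists a $(T_i)_{i}$-invariant closed subspace $X_0$ of $X$ such that $X_0$ has a residual subset (residual in $X_0$) of absolutely mean irregular vectors.
   Context: A sequence $(T_i)_{i=1}^\infty$ of bounded linear operators on a Banach space $X$ (i.e. from $X$ to $X$) is \emph{submultiplicative} if there exists a constant $C>0$ such that $\Vert T_{i+m}z\Vert\le C\Vert T_iT_mz\Vert$ for all $z\in X$ and $i,m\in\mathbb{N}=\{1,2,\dots\}$. It is \emph{almost-commuting} if $\lim_{i\to\infty}(T_iT_k-T_kT_i)x=0$ for all $x\in X$ and $k\in\mathbb{N}$. A subspace $X_0$ is \emph{$(T_i)_i$-invariant} if $T_kX_0\subset X_0$ for all $k\in\mathbb{N}$. A pair $(x,y)\in X\times X$ is a \emph{mean Li-Yorke pair} if $\liminf_{n\to\infty}\frac1n\sum_{i=1}^n\Vert T_ix-T_iy\Vert=0$ and $\limsup_{n\to\infty}\frac1n\sum_{i=1}^n\Vert T_ix-T_iy\Vert>0$. A subset of $X$ is \emph{mean Li-Yorke scrambled} if any two distinct points of it form a mean Li-Yorke pair; $(T_i)_i$ is \emph{mean Li-Yorke chaotic} if there exists an uncountable mean Li-Yorke scrambled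 subset of $X$. A vector $x\in X$ is \emph{absolutely mean semi-irregular} (resp. \emph{absolutely mean irregular}) if $\liminf_{n\to\infty}\frac1n\sum_{i=1}^n\Vert T_ix\Vert=0$ and $\limsup_{n\to\infty}\frac1n\sum_{i=1}^n\Vert T_ix\Vert>0$ (resp. $=\infty$). A set is residual if it contains a dense $G_\delta$ set. *)

theory Defs
  imports "HOL-Analysis.Analysis"
begin

text \<open>
  Banach spaces over \<open>\<real>\<close> or \<open>\<complex>\<close> are treated uniformly.  The class \<^class>\<open>banach\<close> only
  provides the underlying real Banach space; the scalar multiplication is an explicit
  operation \<open>smul\<close>.  By the Gelfand--Mazur theorem a \<^class>\<open>real_normed_field\<close>
  (whose norm is multiplicative) is isomorphic to \<open>\<real>\<close> or \<open>\<complex>\<close>, so these are exactly the two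
  possible scalar fields.  For \<open>smul = (*\<^sub>R)\<close> one gets real Banach spaces.
\<close>

locale banach_over = vector_space smul
  for smul :: "'k::real_normed_field \<Rightarrow> 'a::banach \<Rightarrow> 'a" +
  assumes smul_of_real: "smul (of_real r) x = r *\<^sub>R x"
    and norm_smul: "norm (smul c x) = norm c * norm x"

definition bounded_operator :: "('k::real_normed_field \<Rightarrow> 'a::banach \<Rightarrow> 'a) \<Rightarrow> ('a \<Rightarrow> 'a) \<Rightarrow> bool"
  where "bounded_operator smul S \<longleftrightarrow>
    Vector_Spaces.linear smul smul S \<and> (\<exists>K. \<forall>x. norm (S x) \<le> K * norm x)"

text \<open>
  A sequence of operators indexed by \<open>1, 2, \<dots>\<close> is a function on \<^typ>\<open>nat\<close> whose value at
  \<open>0\<close> is never used.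
\<close>

definition submultiplicative :: "(nat \<Rightarrow> 'a::real_normed_vector \<Rightarrow> 'a) \<Rightarrow> bool"
  where "submultiplicative T \<longleftrightarrow>
    (\<exists>C>0. \<forall>z. \<forall>i\<ge>1. \<forall>m\<ge>1. norm (T (i + m) z) \<le> C * norm (T i (T m z)))"

definition almost_commuting :: "(nat \<Rightarrow> 'a::real_normed_vector \<Rightarrow> 'a) \<Rightarrow> bool"
  where "almost_commuting T \<longleftrightarrow>
    (\<forall>x. \<forall>k\<ge>1. (\<lambda>i. T i (T k x) - T k (T i x)) \<longlonglongrightarrow> 0)"

definition invariant_under :: "(nat \<Rightarrow> 'a \<Rightarrow> 'a) \<Rightarrow> 'a set \<Rightarrow> bool"
  where "invariant_under T X0 \<longleftrightarrow> (\<forall>k\<ge>1. T k ` X0 \<subseteq> X0)"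

text \<open>The values at \<open>n = 0\<close> of the averages below do not affect the limits.\<close>

definition mean_dist :: "(nat \<Rightarrow> 'a::real_normed_vector \<Rightarrow> 'a) \<Rightarrow> 'a \<Rightarrow> 'a \<Rightarrow> nat \<Rightarrow> ereal"
  where "mean_dist T x y n = ereal (1 / real n * (\<Sum>i=1..n. norm (T i x - T i y)))"

definition mean_norm :: "(nat \<Rightarrow> 'a::real_normed_vector \<Rightarrow> 'a) \<Rightarrow> 'a \<Rightarrow> nat \<Rightarrow> ereal"
  where "mean_norm T x n = ereal (1 / real n * (\<Sum>i=1..n. norm (T i x)))"

definition mean_Li_Yorke_pair :: "(nat \<Rightarrow> 'a::real_normed_vector \<Rightarrow> 'a) \<Rightarrow> 'a \<Rightarrow> 'a \<Rightarrow> bool"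
  where "mean_Li_Yorke_pair T x y \<longleftrightarrow>
    liminf (mean_dist T x y) = 0 \<and> limsup (mean_dist T x y) > 0"

definition mean_Li_Yorke_scrambled :: "(nat \<Rightarrow> 'a::real_normed_vector \<Rightarrow> 'a) \<Rightarrow> 'a set \<Rightarrow> bool"
  where "mean_Li_Yorke_scrambled T S \<longleftrightarrow>
    (\<forall>x\<in>S. \<forall>y\<in>S. x \<noteq> y \<longrightarrow> mean_Li_Yorke_pair T x y)"

definition mean_Li_Yorke_chaotic :: "(nat \<Rightarrow> 'a::real_normed_vector \<Rightarrow> 'a) \<Rightarrow> bool"
  where "mean_Li_Yorke_chaotic T \<longleftrightarrow> (\<exists>S. uncountable S \<and> mean_Li_Yorke_scrambled T S)"

definition abs_mean_semi_irregular :: "(nat \<Rightarrow> 'a::real_normed_vector \<Rightarrow> 'a) \<Rightarrow> 'a \<Rightarrow> bool"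
  where "abs_mean_semi_irregular T x \<longleftrightarrow>
    liminf (mean_norm T x) = 0 \<and> limsup (mean_norm T x) > 0"

definition abs_mean_irregular :: "(nat \<Rightarrow> 'a::real_normed_vector \<Rightarrow> 'a) \<Rightarrow> 'a \<Rightarrow> bool"
  where "abs_mean_irregular T x \<longleftrightarrow>
    liminf (mean_norm T x) = 0 \<and> limsup (mean_norm T x) = \<infinity>"

definition residual_in :: "'a topology \<Rightarrow> 'a set \<Rightarrow> bool"
  where "residual_in X R \<longleftrightarrow> R \<subseteq> topspace X \<and>
    (\<exists>D\<subseteq>R. gdelta_in X D \<and> X closure_of D = topspace X)"

end

theory Submission
  imports Defs
begin

text \<open>
  Given a semi-irregular vector \<open>x\<close>, fix \<open>r\<close> with \<open>r j \<longlonglongrightarrow> \<infinity>\<close> along which the means of \<open>x\<close> tend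
  to \<open>0\<close>, and let \<open>X0\<close> be the closure of the subspace of all vectors whose means tend to \<open>0\<close> along
  \<open>r\<close>.  Almost-commutation makes this subspace invariant, so the vectors of \<open>X0\<close> whose means have
  lower limit \<open>0\<close> form a dense \<open>G\<^sub>\<delta>\<close> in \<open>X0\<close>.  If the vectors with unbounded means
  were not residual in \<open>X0\<close>, the means would be bounded by \<open>K \<parallel>z\<parallel>\<close> on \<open>X0\<close>; applied to \<open>z = T m x\<close>
  with \<open>\<parallel>T m x\<parallel>\<close> small, submultiplicativity would then force the means of \<open>x\<close> to converge to \<open>0\<close>.
  Baire's theorem combines the two residual sets.  The real line through
  a semi-irregular vector is scrambled.
\<close>

section \<open>Limits of real sequences, Cesaro means and closures of subspaces\<close>

lemma liminf_ereal_eq_0_iff: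
  fixes a :: "nat \<Rightarrow> real"
  assumes nonneg: "\<And>n. 0 \<le> a n"
  shows "liminf (\<lambda>n. ereal (a n)) = 0 \<longleftrightarrow> (\<forall>k. \<exists>n>k. a n < inverse (real (Suc k)))"
proof
  assume lim: "liminf (\<lambda>n. ereal (a n)) = 0"
  show "\<forall>k. \<exists>n>k. a n < inverse (real (Suc k))"
  proof
    fix k
    have "liminf (\<lambda>n. ereal (a n)) < ereal (inverse (real (Suc k)))"
      unfolding lim by simp
    from liminf_upper_bound[OF this, of k] show "\<exists>n>k. a n < inverse (real (Suc k))"
      by auto
  qed
next
  assume small: "\<forall>k. \<exists>n>k. a n < inverse (real (Suc k))"
  have "0 \<le> liminf (\<lambda>n. ereal (a n))"
    by (rule Liminf_bounded) (simp add: nonneg)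
  moreover have "\<not> 0 < liminf (\<lambda>n. ereal (a n))"
  proof
    assume "0 < liminf (\<lambda>n. ereal (a n))"
    then obtain e where e: "0 < ereal e" "ereal e < liminf (\<lambda>n. ereal (a n))"
      using ereal_dense2 by blast
    from less_LiminfD[OF e(2)] obtain N where N: "\<And>n. n \<ge> N \<Longrightarrow> e < a n"
      by (auto simp: eventually_sequentially)
    obtain k where k: "inverse (real (Suc k)) < e"
      using reals_Archimedean e(1) by auto
    \<comment> \<open>A single parameter governs both the index and the tolerance;
      \<open>max k N\<close> pushes \<open>n\<close> beyond \<open>N\<close> while keeping the
      tolerance at most \<open>inverse (real (Suc k))\<close>.\<close>
    obtain n where n: "n > max k N" "a n < inverse (real (Suc (max k N)))"
      using small by blast
    have "inverse (real (Suc (max k N))) \<le> inverse (real (Suc k))"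
      by (intro le_imp_inverse_le) auto
    with N[of n] n k show False
      by auto
  qed
  ultimately show "liminf (\<lambda>n. ereal (a n)) = 0"
    by (metis order_le_less)
qed

text \<open>A real sequence with upper limit below infinity is bounded above, since finitely many
  real terms cannot spoil a bound on the tail. Hence no lower bound on \<open>n\<close> has to be
  imposed.\<close>

lemma limsup_ereal_eq_PInfty_iff:
  fixes a :: "nat \<Rightarrow> real"
  shows "limsup (\<lambda>n. ereal (a n)) = \<infinity> \<longleftrightarrow> (\<forall>k. \<exists>n. real k < a n)"
proof
  assume lim: "limsup (\<lambda>n. ereal (a n)) = \<infinity>"
  show "\<forall>k. \<exists>n. real k < a n"
  proof (rule ccontr)
    assume "\<not> ?thesis"
    then obtain k where "\<And>n. a n \<le> real k"
      by (meson not_less)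
    then have "limsup (\<lambda>n. ereal (a n)) \<le> ereal (real k)"
      by (intro Limsup_bounded) auto
    with lim show False
      by simp
  qed
next
  assume unb: "\<forall>k. \<exists>n. real k < a n"
  show "limsup (\<lambda>n. ereal (a n)) = \<infinity>"
  proof (rule ccontr)
    assume "\<not> ?thesis"
    then obtain C where C: "\<And>n. a n \<le> C"
      using limsup_finite_then_bounded[of a] by (auto simp: less_top)
    obtain k where "C < real k"
      using reals_Archimedean2 by blast
    with unb C show False
      by (meson less_le_trans not_less order_less_imp_le)
  qed
qed

lemma eventually_const_div_nat_less:
  fixes S e :: real
  assumes "e > 0"
  shows "eventually (\<lambda>n. S / real n < e) sequentially"
proof -
  have "(\<lambda>n. S / real n) \<longlonglongrightarrow> 0"
    by (rule lim_const_over_n)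
  then show ?thesis
    using assms by (rule order_tendstoD)
qed

text \<open>Terms of index below \<open>N\<close> contribute at most a fixed sum \<open>S\<close>,
  which disappears after division by \<open>n\<close>; every later term is below \<open>e/2\<close>.
  The lemma serves to average the norms of commutators.\<close>

lemma Cesaro_null:
  fixes f :: "nat \<Rightarrow> real"
  assumes nonneg: "\<And>i. 0 \<le> f i" and f: "f \<longlonglongrightarrow> 0"
  shows "(\<lambda>n. 1 / real n * (\<Sum>i=1..n. f i)) \<longlonglongrightarrow> 0"
proof (rule order_tendstoI)
  fix e :: real
  assume "e < 0"
  then show "eventually (\<lambda>n. e < 1 / real n * (\<Sum>i=1..n. f i)) sequentially"
    by (intro always_eventually allI) (erule less_le_trans, simp add: nonneg sum_nonneg)
next
  fix e :: real
  assume e: "0 < e"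
  then obtain N where N: "\<And>i. i \<ge> N \<Longrightarrow> f i < e/2"
    using order_tendstoD(2)[OF f, of "e/2"] by (auto simp: eventually_sequentially)
  define S where "S = (\<Sum>i<N. f i)"
  have bound: "(\<Sum>i=1..n. f i) \<le> S + real n * (e/2)" for n
  proof -
    have "(\<Sum>i=1..n. f i) \<le> (\<Sum>i=1..n. (if i < N then f i else 0) + e/2)"
      using N e by (intro sum_mono) (auto simp: not_less intro: less_imp_le)
    also have "\<dots> = (\<Sum>i\<in>{1..n} \<inter> {..<N}. f i) + real n * (e/2)"
      by (simp add: sum.distrib sum.inter_restrict)
    also have "(\<Sum>i\<in>{1..n} \<inter> {..<N}. f i) \<le> S"
      unfolding S_def by (intro sum_mono2) (auto simp: nonneg)
    finally show ?thesis
      by simp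
  qed
  have "eventually (\<lambda>n. n > 0) sequentially"
    by (rule eventually_gt_at_top)
  moreover have "eventually (\<lambda>n. S / real n < e/2) sequentially"
    by (rule eventually_const_div_nat_less) (use e in simp)
  ultimately show "eventually (\<lambda>n. 1 / real n * (\<Sum>i=1..n. f i) < e) sequentially"
  proof eventually_elim
    case (elim n)
    have "1 / real n * (\<Sum>i=1..n. f i) \<le> 1 / real n * (S + real n * (e/2))"
      by (intro mult_left_mono bound) simp
    also have "\<dots> = S / real n + e/2"
      using elim by (simp add: field_simps)
    finally show ?case
      using elim by linarith
  qed
qed

lemma subspace_closure:
  fixes S :: "'a::real_normed_vector set"
  assumes S: "subspace S"
  shows "subspace (closure S)"
proof (rule subspaceI)
  show "0 \<in> closure S"
    using subspace_0[OF S] closure_subset by blast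
next
  fix x y
  assume "x \<in> closure S" "y \<in> closure S"
  then obtain f g where "\<forall>n. f n \<in> S" "f \<longlonglongrightarrow> x" "\<forall>n. g n \<in> S" "g \<longlonglongrightarrow> y"
    unfolding closure_sequential by blast
  then have "\<forall>n. f n + g n \<in> S" "(\<lambda>n. f n + g n) \<longlonglongrightarrow> x + y"
    using S by (auto intro: subspace_add tendsto_add)
  then show "x + y \<in> closure S"
    unfolding closure_sequential by (intro exI[of _ "\<lambda>n. f n + g n"] conjI)
next
  fix c :: real and x
  assume "x \<in> closure S"
  then obtain f where "\<forall>n. f n \<in> S" "f \<longlonglongrightarrow> x"
    unfolding closure_sequential by blast
  then have "\<forall>n. c *\<^sub>R f n \<in> S" "(\<lambda>n. c *\<^sub>R f n) \<longlonglongrightarrow> c *\<^sub>R x"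
    using S by (auto intro: subspace_scale tendsto_scaleR)
  then show "c *\<^sub>R x \<in> closure S"
    unfolding closure_sequential by (intro exI[of _ "\<lambda>n. c *\<^sub>R f n"] conjI)
qed

section \<open>Averages of the norms along an orbit\<close>

definition avg :: "(nat \<Rightarrow> 'a::real_normed_vector \<Rightarrow> 'a) \<Rightarrow> 'a \<Rightarrow> nat \<Rightarrow> real"
  where "avg T x n = 1 / real n * (\<Sum>i=1..n. norm (T i x))"

text \<open>One index sequence \<open>r\<close> is shared by all vectors, so that sums stay in the
  set; vectors whose means merely have lower limit \<open>0\<close> need not be closed under
  addition.\<close>

definition null_along :: "(nat \<Rightarrow> 'a::real_normed_vector \<Rightarrow> 'a) \<Rightarrow> (nat \<Rightarrow> nat) \<Rightarrow> 'a set"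
  where "null_along T r = {y. (\<lambda>j. avg T y (r j)) \<longlonglongrightarrow> 0}"

text \<open>Moves the averages from the extended reals to the reals, where continuity and seminorm
  estimates are available.\<close>

lemma mean_norm_avg: "mean_norm T x = (\<lambda>n. ereal (avg T x n))"
  by (simp add: fun_eq_iff mean_norm_def avg_def)

lemma avg_nonneg: "0 \<le> avg T x n"
  by (simp add: avg_def sum_nonneg)

lemma liminf_mean_norm_eq_0_iff:
  "liminf (mean_norm T x) = 0 \<longleftrightarrow> (\<forall>k. \<exists>n>k. avg T x n < inverse (real (Suc k)))"
  by (simp only: mean_norm_avg liminf_ereal_eq_0_iff[OF avg_nonneg])

text \<open>Irregularity becomes a countable conjunction of strict inequalities between averages. As
  averages are continuous in \<open>x\<close>, this exhibits the irregular vectors as a countable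
  intersection of open sets.\<close>

lemma abs_mean_irregular_iff:
  "abs_mean_irregular T x \<longleftrightarrow>
    (\<forall>k. \<exists>n>k. avg T x n < inverse (real (Suc k))) \<and> (\<forall>k. \<exists>n. real k < avg T x n)"
  unfolding abs_mean_irregular_def liminf_mean_norm_eq_0_iff
  by (simp only: mean_norm_avg limsup_ereal_eq_PInfty_iff)

lemma abs_mean_irregular_imp_semi: "abs_mean_irregular T x \<Longrightarrow> abs_mean_semi_irregular T x"
  by (simp add: abs_mean_irregular_def abs_mean_semi_irregular_def)

lemma avg_homogeneous:
  assumes "\<And>i. i \<ge> 1 \<Longrightarrow> norm (T i y) = c * norm (T i x)"
  shows "avg T y n = c * avg T x n"
proof -
  have "(\<Sum>i=1..n. norm (T i y)) = (\<Sum>i=1..n. c * norm (T i x))"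
    using assms by (intro sum.cong) auto
  then show ?thesis
    by (simp add: avg_def sum_distrib_left[symmetric])
qed

text \<open>Terms that are all at least \<open>e\<close> have mean at least \<open>e\<close>. The
  condition on \<open>n\<close> excludes the empty average \<open>avg T x 0 = 0\<close>.\<close>

lemma avg_small_imp_norm_small:
  assumes "avg T x n < e" "n \<ge> 1"
  obtains m where "m \<ge> 1" "norm (T m x) < e"
proof -
  have "\<exists>m\<in>{1..n}. norm (T m x) < e"
  proof (rule ccontr)
    assume "\<not> ?thesis"
    then have "(\<Sum>i=1..n. e) \<le> (\<Sum>i=1..n. norm (T i x))"
      by (intro sum_mono) (simp add: not_less)
    then show False
      using assms by (simp add: avg_def field_simps)
  qed
  then show thesis
    using that by auto
qed

text \<open>By submultiplicativity the mean of \<open>T m x\<close> controls that of \<open>x\<close> up to the first \<open>m\<close> terms.\<close>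
lemma avg_tendsto_0_of_bounded:
  assumes sub: "submultiplicative T"
    and bounded: "\<And>m n. m \<ge> 1 \<Longrightarrow> avg T (T m x) n \<le> K * norm (T m x)"
    and small: "\<And>e. e > 0 \<Longrightarrow> \<exists>m\<ge>1. norm (T m x) < e"
  shows "avg T x \<longlonglongrightarrow> 0"
proof (rule order_tendstoI)
  fix e :: real
  assume "e < 0"
  then show "eventually (\<lambda>n. e < avg T x n) sequentially"
    by (intro always_eventually allI) (erule less_le_trans, rule avg_nonneg)
next
  fix e :: real
  assume e: "0 < e"
  obtain C where C: "C > 0"
    and T: "\<And>z i m. i \<ge> 1 \<Longrightarrow> m \<ge> 1 \<Longrightarrow> norm (T (i + m) z) \<le> C * norm (T i (T m z))"
    using sub by (auto simp: submultiplicative_def)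
  \<comment> \<open>Replacing \<open>K\<close> by a positive bound allows division by it in the
    choice of the tolerance for \<open>norm (T m x)\<close>.\<close>
  define L where "L = max K 1"
  have L: "L > 0"
    by (simp add: L_def)
  have "e / (2 * C * L) > 0"
    using e C L by simp
  from small[OF this] obtain m where m: "m \<ge> 1" "norm (T m x) < e / (2 * C * L)"
    by blast
  have m': "C * (L * norm (T m x)) < e/2"
    using m(2) C L by (simp add: field_simps)
  define S where "S = (\<Sum>i=1..m. norm (T i x))"
  have bound: "avg T x n \<le> S / real n + C * (L * norm (T m x))" if n: "n > m" for n
  proof -
    obtain p where p: "n = m + p"
      using n less_imp_add_positive by blast
    have p0: "p > 0"
      using n p by simp
    have "avg T (T m x) p \<le> L * norm (T m x)"
      by (rule order_trans[OF bounded[OF m(1)]]) (simp add: L_def mult_right_mono)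
    then have tail: "(\<Sum>i=1..p. norm (T i (T m x))) \<le> real p * (L * norm (T m x))"
      using p0 by (simp add: avg_def field_simps)
    have "(\<Sum>i=1..n. norm (T i x)) = S + (\<Sum>i=m+1..m+p. norm (T i x))"
      unfolding S_def p by (rule sum.ub_add_nat) simp
    also have "(\<Sum>i=m+1..m+p. norm (T i x)) = (\<Sum>i=1..p. norm (T (i + m) x))"
      using sum.shift_bounds_cl_nat_ivl[of "\<lambda>i. norm (T i x)" 1 m p] by (simp add: add.commute)
    also have "\<dots> \<le> (\<Sum>i=1..p. C * norm (T i (T m x)))"
      using T m(1) by (intro sum_mono) auto
    also have "\<dots> = C * (\<Sum>i=1..p. norm (T i (T m x)))"
      by (simp add: sum_distrib_left)
    also have "\<dots> \<le> C * (real p * (L * norm (T m x)))"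
      using tail C by (intro mult_left_mono) auto
    \<comment> \<open>Since \<open>p \<le> n\<close>, the length of the tail may be replaced by
      \<open>n\<close>; division by \<open>n\<close> then leaves a constant below
      \<open>e/2\<close>.\<close>
    also have "\<dots> \<le> C * (real n * (L * norm (T m x)))"
      using C L p by (intro mult_left_mono mult_right_mono) auto
    finally have "(\<Sum>i=1..n. norm (T i x)) \<le> S + real n * (C * (L * norm (T m x)))"
      by (simp add: mult.left_commute)
    then show ?thesis
      using n by (simp add: avg_def field_simps)
  qed
  have "eventually (\<lambda>n. n > m) sequentially"
    by (rule eventually_gt_at_top)
  moreover have "eventually (\<lambda>n. S / real n < e/2) sequentially"
    by (rule eventually_const_div_nat_less) (use e in simp)
  ultimately show "eventually (\<lambda>n. avg T x n < e) sequentially"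
  proof eventually_elim
    case (elim n)
    then show ?case
      using bound[of n] m' by linarith
  qed
qed

section \<open>Averages as seminorms, and invariance of the null subspace\<close>

locale operator_sequence =
  fixes T :: "nat \<Rightarrow> 'a::banach \<Rightarrow> 'a"
  assumes bounded_linear_T: "i \<ge> 1 \<Longrightarrow> bounded_linear (T i)"
begin

lemma avg_scaleR: "avg T (c *\<^sub>R x) n = \<bar>c\<bar> * avg T x n"
  by (rule avg_homogeneous) (simp add: linear_simps(5)[OF bounded_linear_T])

lemma avg_add_le: "avg T (x + y) n \<le> avg T x n + avg T y n"
proof -
  have "(\<Sum>i=1..n. norm (T i (x + y))) \<le> (\<Sum>i=1..n. norm (T i x) + norm (T i y))"
    by (intro sum_mono) (simp add: linear_simps(1)[OF bounded_linear_T] norm_triangle_ineq)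
  then have "1 / real n * (\<Sum>i=1..n. norm (T i (x + y)))
      \<le> 1 / real n * (\<Sum>i=1..n. norm (T i x) + norm (T i y))"
    by (intro mult_left_mono) auto
  then show ?thesis
    by (simp add: avg_def sum.distrib distrib_left add_divide_distrib)
qed

lemma avg_diff_le: "avg T (x - y) n \<le> avg T x n + avg T y n"
  using avg_add_le[of x "(-1) *\<^sub>R y" n] unfolding avg_scaleR by simp

lemma continuous_on_avg: "continuous_on A (\<lambda>y. avg T y n)"
  unfolding avg_def
  by (intro continuous_on_mult continuous_on_const continuous_on_sum continuous_on_norm
      linear_continuous_on bounded_linear_T) auto

lemma subspace_null_along: "subspace (null_along T r)"
proof (rule subspaceI)
  show "0 \<in> null_along T r"
    using avg_scaleR[of 0 0] by (simp add: null_along_def)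
next
  fix x y
  assume "x \<in> null_along T r" "y \<in> null_along T r"
  then have "(\<lambda>j. avg T x (r j) + avg T y (r j)) \<longlonglongrightarrow> 0 + 0"
    unfolding null_along_def by (intro tendsto_add) auto
  then show "x + y \<in> null_along T r"
    unfolding null_along_def
    by (auto intro: Lim_null_comparison[rotated] always_eventually simp: avg_add_le avg_nonneg)
next
  fix c :: real and x
  assume "x \<in> null_along T r"
  then show "c *\<^sub>R x \<in> null_along T r"
    by (simp add: null_along_def avg_scaleR tendsto_mult_right_zero)
qed

text \<open>The norm of \<open>T i (T k x)\<close> is at most the commutator norm \<open>f i\<close>
  plus \<open>B * norm (T i x)\<close>. The commutator norms tend to \<open>0\<close>, hence so do
  their Cesaro means, and \<open>r\<close> tending to infinity carries this over to the indices
  \<open>r j\<close>.\<close>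

lemma invariant_null_along:
  assumes ac: "almost_commuting T" and r: "filterlim r at_top sequentially"
  shows "invariant_under T (null_along T r)"
  unfolding invariant_under_def
proof safe
  fix k x
  assume k: "(1::nat) \<le> k" and x: "x \<in> null_along T r"
  obtain B where B: "\<And>z. norm (T k z) \<le> norm z * B"
    using bounded_linear.bounded[OF bounded_linear_T[OF k]] by blast
  define f where "f = (\<lambda>i. norm (T i (T k x) - T k (T i x)))"
  have "f \<longlonglongrightarrow> 0"
    using ac k unfolding almost_commuting_def f_def by (simp add: tendsto_norm_zero)
  then have "(\<lambda>n. 1 / real n * (\<Sum>i=1..n. f i)) \<longlonglongrightarrow> 0"
    by (intro Cesaro_null) (auto simp: f_def)
  then have "(\<lambda>j. 1 / real (r j) * (\<Sum>i=1..r j. f i)) \<longlonglongrightarrow> 0"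
    by (rule filterlim_compose) (rule r)
  moreover have "(\<lambda>j. B * avg T x (r j)) \<longlonglongrightarrow> 0"
    using x by (simp add: null_along_def tendsto_mult_right_zero)
  ultimately have lim: "(\<lambda>j. 1 / real (r j) * (\<Sum>i=1..r j. f i) + B * avg T x (r j)) \<longlonglongrightarrow> 0"
    by (rule tendsto_add_zero)
  have le: "avg T (T k x) n \<le> 1 / real n * (\<Sum>i=1..n. f i) + B * avg T x n" for n
  proof -
    have "norm (T i (T k x)) \<le> f i + B * norm (T i x)" for i
      using norm_triangle_ineq[of "T i (T k x) - T k (T i x)" "T k (T i x)"] B[of "T i x"]
      by (simp add: f_def mult.commute)
    then have "(\<Sum>i=1..n. norm (T i (T k x))) \<le> (\<Sum>i=1..n. f i) + B * (\<Sum>i=1..n. norm (T i x))"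
      by (simp add: sum_mono sum_distrib_left flip: sum.distrib)
    then have "1 / real n * (\<Sum>i=1..n. norm (T i (T k x)))
        \<le> 1 / real n * ((\<Sum>i=1..n. f i) + B * (\<Sum>i=1..n. norm (T i x)))"
      by (intro mult_left_mono) auto
    then show ?thesis
      by (simp add: avg_def distrib_left add_divide_distrib)
  qed
  show "T k x \<in> null_along T r"
    unfolding null_along_def
    by (intro CollectI Lim_null_comparison[OF _ lim] always_eventually allI)
      (simp only: real_norm_def abs_of_nonneg[OF avg_nonneg] le)
qed

lemma invariant_closure:
  assumes "invariant_under T Y"
  shows "invariant_under T (closure Y)"
  unfolding invariant_under_def
proof safe
  fix k x
  assume k: "(1::nat) \<le> k" and x: "x \<in> closure Y"
  have "T k ` closure Y \<subseteq> closure (T k ` Y)"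
    by (intro closure_bounded_linear_image_subset bounded_linear_T k)
  also have "\<dots> \<subseteq> closure Y"
    using assms k by (intro closure_mono) (auto simp: invariant_under_def)
  finally show "T k x \<in> closure Y"
    using x by blast
qed

text \<open>Each average is a seminorm, so a bound \<open>k\<close> on a ball of \<open>X0\<close>
  gives \<open>2 * k\<close> on differences of two of its points, in particular on small multiples
  of \<open>z\<close>. Rescaling keeps the bound uniform in \<open>n\<close>.\<close>

lemma avg_le_norm_of_bounded_near:
  assumes X0: "subspace X0" and y0: "y0 \<in> X0" and e: "e > 0"
    and bounded: "\<And>y n. y \<in> X0 \<Longrightarrow> dist y y0 < e \<Longrightarrow> avg T y n \<le> k"
    and z: "z \<in> X0"
  shows "avg T z n \<le> 4 * k / e * norm z"
proof (cases "z = 0")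
  case True
  then show ?thesis
    using avg_scaleR[of 0 0] by simp
next
  case False
  \<comment> \<open>With this factor the multiple of \<open>z\<close> has norm \<open>e / 2\<close>,
    strictly inside the ball; dividing \<open>2 * k\<close> by \<open>c\<close> produces the
    constant \<open>4 * k / e\<close>.\<close>
  define c where "c = e / (2 * norm z)"
  have c: "c > 0" "c * norm z < e"
    using False e by (simp_all add: c_def)
  have "avg T (y0 + c *\<^sub>R z) n \<le> k"
    using c y0 z X0 by (intro bounded) (auto simp: dist_norm subspace_add subspace_scale)
  moreover have "avg T y0 n \<le> k"
    using e y0 by (intro bounded) auto
  ultimately have "avg T (c *\<^sub>R z) n \<le> 2 * k"
    using avg_diff_le[of "y0 + c *\<^sub>R z" y0 n] by simp
  then have "c * avg T z n \<le> 2 * k"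
    using c by (simp add: avg_scaleR)
  then show ?thesis
    using False e by (simp add: c_def field_simps)
qed

section \<open>Baire category in a closed invariant subspace\<close>

lemma residual_abs_mean_irregular:
  assumes sub: "submultiplicative T"
    and X0: "subspace X0" "closed X0" "invariant_under T X0"
    and x: "x \<in> X0" "abs_mean_semi_irregular T x"
    and dense: "X0 \<subseteq> closure {y \<in> X0. liminf (mean_norm T y) = 0}"
  shows "residual_in (top_of_set X0) {y \<in> X0. abs_mean_irregular T y}"
proof -
  define U where "U k = {y \<in> X0. \<exists>n. real k < avg T y n}" for k
  define V where "V k = {y \<in> X0. \<exists>n>k. avg T y n < inverse (real (Suc k))}" for k
  have irr: "{y \<in> X0. abs_mean_irregular T y} = \<Inter> (range U \<union> range V)"
    unfolding Inter_Un_distrib abs_mean_irregular_iff U_def V_def by (auto simp del: of_nat_Suc)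
  have openU: "openin (top_of_set X0) (U k)" for k
  proof -
    have "U k = X0 \<inter> (\<Union>n. {y. real k < avg T y n})"
      by (auto simp: U_def)
    then show ?thesis
      by (auto intro!: openin_open_Int open_UN open_Collect_less continuous_on_avg
          continuous_on_const)
  qed
  have openV: "openin (top_of_set X0) (V k)" for k
  proof -
    have "V k = X0 \<inter> (\<Union>n\<in>{k<..}. {y. avg T y n < inverse (real (Suc k))})"
      by (auto simp: V_def)
    then show ?thesis
      by (auto intro!: openin_open_Int open_UN open_Collect_less continuous_on_avg
          continuous_on_const simp del: of_nat_Suc)
  qed
  \<comment> \<open>If density fails, some ball of \<open>X0\<close> around \<open>y0\<close> misses
    \<open>U k\<close>, so all averages of its points are at most \<open>k\<close>; this local bound
    spreads to a multiple of the norm on the whole of \<open>X0\<close>.\<close>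
  have denseU: "X0 \<subseteq> closure (U k)" for k
  proof (rule ccontr)
    assume "\<not> ?thesis"
    then obtain y0 where y0: "y0 \<in> X0" "y0 \<notin> closure (U k)"
      by blast
    then obtain e where e: "e > 0" "\<And>y. y \<in> U k \<Longrightarrow> \<not> dist y y0 < e"
      by (auto simp: closure_approachable)
    have near: "avg T y n \<le> real k" if "y \<in> X0" "dist y y0 < e" for y n
    proof -
      have "y \<notin> U k"
        using e(2) that(2) by blast
      then show ?thesis
        using that(1) by (auto simp: U_def not_less)
    qed
    have bounded: "avg T z n \<le> 4 * real k / e * norm z" if "z \<in> X0" for z n
      using X0(1) y0(1) e(1) near that by (rule avg_le_norm_of_bounded_near)
    \<comment> \<open>Invariance places every \<open>T m x\<close> in \<open>X0\<close>, where the
      linear bound applies. The resulting limit contradicts the positive upper limit of the means of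
      \<open>x\<close>.\<close>
    have "avg T x \<longlonglongrightarrow> 0"
    proof (rule avg_tendsto_0_of_bounded[OF sub])
      fix m n :: nat
      assume "m \<ge> 1"
      then show "avg T (T m x) n \<le> 4 * real k / e * norm (T m x)"
        using X0(3) x(1) by (intro bounded) (auto simp: invariant_under_def)
    next
      fix d :: real
      assume "d > 0"
      then obtain j where j: "inverse (real (Suc j)) < d"
        using reals_Archimedean by blast
      obtain n where n: "n > j" "avg T x n < inverse (real (Suc j))"
        using x(2) unfolding abs_mean_semi_irregular_def liminf_mean_norm_eq_0_iff by blast
      have "avg T x n < d" "n \<ge> 1"
        using n j by linarith+
      then show "\<exists>m\<ge>1. norm (T m x) < d"
        by (meson avg_small_imp_norm_small)
    qed
    then have "mean_norm T x \<longlonglongrightarrow> 0"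
      by (simp add: mean_norm_avg zero_ereal_def)
    then have "limsup (mean_norm T x) = 0"
      by (intro lim_imp_Limsup) auto
    with x(2) show False
      by (simp add: abs_mean_semi_irregular_def)
  qed
  have denseV: "X0 \<subseteq> closure (V k)" for k
  proof -
    have "{y \<in> X0. liminf (mean_norm T y) = 0} \<subseteq> V k"
      unfolding V_def liminf_mean_norm_eq_0_iff by blast
    with dense show ?thesis
      using closure_mono by blast
  qed
  have "openin (top_of_set X0) W \<and> top_of_set X0 closure_of W = topspace (top_of_set X0)"
    if "W \<in> range U \<union> range V" for W
  proof -
    have W: "openin (top_of_set X0) W" "X0 \<subseteq> closure W"
      using that openU openV denseU denseV by blast+
    moreover have "W \<subseteq> X0"
      using W(1) openin_imp_subset by blast
    ultimately show ?thesis
      by (auto simp: closure_of_subtopology Int_absorb1)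
  qed
  note W = this
  \<comment> \<open>Closedness of \<open>X0\<close> in the Banach space makes it completely
    metrizable in its own topology, as Baire's theorem requires.\<close>
  have "completely_metrizable_space (top_of_set X0)"
    using X0(2) by (simp add: completely_metrizable_space_closedin completely_metrizable_space_euclidean)
  then have "top_of_set X0 closure_of \<Inter> (range U \<union> range V) = topspace (top_of_set X0)"
    using W by (intro Baire_category) auto
  moreover have "gdelta_in (top_of_set X0) (\<Inter> (range U \<union> range V))"
    using W by (intro gdelta_in_Inter) (auto intro: open_imp_gdelta_in)
  ultimately show ?thesis
    unfolding residual_in_def irr[symmetric] by auto
qed

lemma semi_irregular_imp_residual_irregular:
  assumes ac: "almost_commuting T" and sub: "submultiplicative T"
    and x: "abs_mean_semi_irregular T x"
  obtains r where "invariant_under T (closure (null_along T r))"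
    and "residual_in (top_of_set (closure (null_along T r)))
      {y \<in> closure (null_along T r). abs_mean_irregular T y}"
proof -
  have "\<forall>k. \<exists>n>k. avg T x n < inverse (real (Suc k))"
    using x unfolding abs_mean_semi_irregular_def liminf_mean_norm_eq_0_iff by blast
  \<comment> \<open>The bound \<open>r k > k\<close> makes \<open>r\<close> tend to infinity, and
    the bound on the averages puts \<open>x\<close> itself into
    \<open>null_along T r\<close>.\<close>
  then obtain r where r: "\<And>k. r k > k" "\<And>k. avg T x (r k) < inverse (real (Suc k))"
    by metis
  have r_top: "filterlim r at_top sequentially"
    by (rule filterlim_at_top_mono[OF filterlim_ident]) (auto simp: r(1) less_imp_le)
  have "(\<lambda>k. avg T x (r k)) \<longlonglongrightarrow> 0"
    by (rule Lim_null_comparison[OF _ LIMSEQ_inverse_real_of_nat])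
      (use r(2) in \<open>auto simp: avg_nonneg less_imp_le\<close>)
  then have x_null: "x \<in> null_along T r"
    by (simp add: null_along_def)
  \<comment> \<open>Convergence along \<open>r\<close> yields small averages, and
    \<open>r j > j > k\<close> supplies them at indices beyond \<open>k\<close>.\<close>
  have liminf: "liminf (mean_norm T y) = 0" if "y \<in> null_along T r" for y
    unfolding liminf_mean_norm_eq_0_iff
  proof
    fix k
    have "eventually (\<lambda>j. avg T y (r j) < inverse (real (Suc k))) sequentially"
      using that unfolding null_along_def by (intro order_tendstoD) auto
    moreover have "eventually (\<lambda>j. j > k) sequentially"
      by (rule eventually_gt_at_top)
    ultimately have "eventually (\<lambda>j. r j > k \<and> avg T y (r j) < inverse (real (Suc k))) sequentially"
      by eventually_elim (use r(1) less_trans in blast)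
    then show "\<exists>n>k. avg T y n < inverse (real (Suc k))"
      using eventually_happens'[OF sequentially_bot] by blast
  qed
  let ?X0 = "closure (null_along T r)"
  have inv: "invariant_under T ?X0"
    by (intro invariant_closure invariant_null_along ac r_top)
  have "residual_in (top_of_set ?X0) {y \<in> ?X0. abs_mean_irregular T y}"
  proof (rule residual_abs_mean_irregular[OF sub _ _ inv _ x])
    show "subspace ?X0"
      by (intro subspace_closure subspace_null_along)
    show "x \<in> ?X0"
      using x_null closure_subset by blast
    show "?X0 \<subseteq> closure {y \<in> ?X0. liminf (mean_norm T y) = 0}"
      using liminf closure_subset by (intro closure_mono) auto
  qed simp
  with inv show thesis
    by (rule that)
qed

text \<open>The difference of two distinct multiples of \<open>x\<close> is a nonzero multiple of
  \<open>x\<close>, and its means are those of \<open>x\<close> times a positive constant.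
  Semi-irregularity forces \<open>x\<close> to be nonzero, so the real line through \<open>x\<close>
  is uncountable.\<close>

lemma semi_irregular_imp_chaotic:
  assumes x: "abs_mean_semi_irregular T x"
  shows "mean_Li_Yorke_chaotic T"
proof -
  define S where "S = range (\<lambda>t::real. t *\<^sub>R x)"
  have "avg T 0 n = 0" for n
    using avg_scaleR[of 0 0] by simp
  then have "x \<noteq> 0"
    using x by (auto simp: abs_mean_semi_irregular_def mean_norm_avg Limsup_const)
  then have "inj (\<lambda>t::real. t *\<^sub>R x)"
    by (auto intro: injI)
  then have "uncountable S"
    unfolding S_def using uncountable_UNIV_real countable_image_inj_on by blast
  moreover have "mean_Li_Yorke_pair T (s *\<^sub>R x) (t *\<^sub>R x)" if "s \<noteq> t" for s t
  proof -
    have eq: "mean_dist T (s *\<^sub>R x) (t *\<^sub>R x) = (\<lambda>n. ereal \<bar>s - t\<bar> * mean_norm T x n)"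
    proof
      fix n
      have "(\<Sum>i=1..n. norm (T i (s *\<^sub>R x) - T i (t *\<^sub>R x))) = (\<Sum>i=1..n. norm (T i ((s - t) *\<^sub>R x)))"
        by (intro sum.cong)
          (auto simp: linear_simps(2)[OF bounded_linear_T] algebra_simps)
      then show "mean_dist T (s *\<^sub>R x) (t *\<^sub>R x) n = ereal \<bar>s - t\<bar> * mean_norm T x n"
        using avg_scaleR[of "s - t" x n] by (simp add: mean_dist_def mean_norm_def avg_def)
    qed
    have "liminf (mean_dist T (s *\<^sub>R x) (t *\<^sub>R x)) = ereal \<bar>s - t\<bar> * liminf (mean_norm T x)"
      unfolding eq by (rule Liminf_ereal_mult_left) auto
    moreover have "limsup (mean_dist T (s *\<^sub>R x) (t *\<^sub>R x)) = ereal \<bar>s - t\<bar> * limsup (mean_norm T x)"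
      unfolding eq by (rule Limsup_ereal_mult_left) auto
    ultimately show ?thesis
      using x that
      by (simp add: mean_Li_Yorke_pair_def abs_mean_semi_irregular_def ereal_zero_less_0_iff)
  qed
  then have "mean_Li_Yorke_scrambled T S"
    by (auto simp: mean_Li_Yorke_scrambled_def S_def)
  ultimately show ?thesis
    by (auto simp: mean_Li_Yorke_chaotic_def)
qed

text \<open>By linearity the distance of two orbits is the norm of the orbit of the difference,
  which reduces pairs to single vectors.\<close>

lemma mean_Li_Yorke_pair_iff: "mean_Li_Yorke_pair T x y \<longleftrightarrow> abs_mean_semi_irregular T (x - y)"
proof -
  have "mean_dist T x y = mean_norm T (x - y)"
    by (auto simp: fun_eq_iff mean_dist_def mean_norm_def linear_simps(2)[OF bounded_linear_T]
        intro!: sum.cong)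
  then show ?thesis
    by (simp add: mean_Li_Yorke_pair_def abs_mean_semi_irregular_def)
qed

end

section \<open>Passage from real scalars to the field \<open>'k\<close>\<close>

context banach_over
begin

text \<open>As \<open>smul\<close> extends real scaling, linearity over \<open>'k\<close> restricts
  to real linearity; this opens \<open>operator_sequence\<close> to the operators of the
  theorem.\<close>

lemma bounded_operator_imp_bounded_linear:
  assumes "bounded_operator smul S"
  shows "bounded_linear S"
proof -
  interpret S: Vector_Spaces.linear smul smul S
    using assms by (simp add: bounded_operator_def)
  obtain K where "\<And>x. norm (S x) \<le> K * norm x"
    using assms by (auto simp: bounded_operator_def)
  then show ?thesis
    by (intro bounded_linear_intro[where K = K])
      (simp_all add: S.add S.scale mult.commute flip: smul_of_real)
qed

lemma bounded_linear_smul: "bounded_linear (smul c)"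
proof (rule bounded_linear_intro[where K = "norm c"])
  show "smul c (r *\<^sub>R x) = r *\<^sub>R smul c x" for r x
    by (simp add: mult.commute flip: smul_of_real)
qed (simp_all add: scale_right_distrib norm_smul mult.commute)

text \<open>Beyond the real case only stability under \<open>smul\<close> is at stake: averages are
  absolutely homogeneous over \<open>'k\<close>, so \<open>null_along T r\<close> is stable, and
  continuity of \<open>smul c\<close> extends this to the closure.\<close>

lemma subspace_closure_null_along:
  assumes T: "\<And>i. i \<ge> 1 \<Longrightarrow> bounded_operator smul (T i)"
  shows "subspace (closure (null_along T r))"
proof -
  interpret operator_sequence T
    by (rule operator_sequence.intro) (rule bounded_operator_imp_bounded_linear[OF T])
  let ?Y = "null_along T r"
  have real: "Real_Vector_Spaces.subspace (closure ?Y)"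
    by (intro subspace_closure subspace_null_along)
  have "avg T (smul c y) n = norm c * avg T y n" for c y n
  proof (rule avg_homogeneous)
    fix i :: nat
    assume "i \<ge> 1"
    then interpret Ti: Vector_Spaces.linear smul smul "T i"
      using T by (simp add: bounded_operator_def)
    show "norm (T i (smul c y)) = norm c * norm (T i y)"
      by (simp add: Ti.scale norm_smul)
  qed
  then have "smul c ` ?Y \<subseteq> ?Y" for c
    by (auto simp: null_along_def tendsto_mult_right_zero)
  then have "smul c ` closure ?Y \<subseteq> closure ?Y" for c
    using closure_bounded_linear_image_subset[OF bounded_linear_smul] closure_mono by blast
  then show ?thesis
    using real by (auto simp: subspace_def real_vector.subspace_def)
qed

end

section \<open>The equivalences, by a cycle of implications\<close>

theorem theorem4p8:
  fixes smul :: "'k::real_normed_field \<Rightarrow> 'a::banach \<Rightarrow> 'a"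
    and T :: "nat \<Rightarrow> 'a \<Rightarrow> 'a"
  assumes "banach_over smul"
    and "\<And>i. i \<ge> 1 \<Longrightarrow> bounded_operator smul (T i)"
    and "almost_commuting T"
    and "submultiplicative T"
  shows "((\<exists>x y. mean_Li_Yorke_pair T x y) \<longleftrightarrow> (\<exists>x. abs_mean_semi_irregular T x)) \<and>
    ((\<exists>x. abs_mean_semi_irregular T x) \<longleftrightarrow> mean_Li_Yorke_chaotic T) \<and>
    (mean_Li_Yorke_chaotic T \<longleftrightarrow> (\<exists>x. abs_mean_irregular T x)) \<and>
    ((\<exists>x. abs_mean_irregular T x) \<longleftrightarrow>
      (\<exists>X0. module.subspace smul X0 \<and> closed X0 \<and> invariant_under T X0 \<and>
        (\<exists>R. residual_in (top_of_set X0) R \<and> (\<forall>x\<in>R. abs_mean_irregular T x))))"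
    (is "(?pair \<longleftrightarrow> ?semi) \<and> (_ \<longleftrightarrow> ?chaos) \<and> (_ \<longleftrightarrow> ?irr) \<and> (_ \<longleftrightarrow> ?res)")
proof -
  interpret banach_over smul
    by fact
  interpret operator_sequence T
    by (rule operator_sequence.intro) (rule bounded_operator_imp_bounded_linear[OF assms(2)])
  have "?pair \<longleftrightarrow> ?semi"
    \<comment> \<open>A pair gives the vector \<open>x - y\<close>; conversely a semi-irregular
      \<open>x\<close> is paired with \<open>0\<close>.\<close>
    unfolding mean_Li_Yorke_pair_iff by (metis diff_zero)
  moreover have "?semi \<Longrightarrow> ?chaos"
    using semi_irregular_imp_chaotic by blast
  moreover have "?chaos \<Longrightarrow> ?pair"
  proof -
    assume ?chaos
    then obtain S where S: "uncountable S" "mean_Li_Yorke_scrambled T S"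
      by (auto simp: mean_Li_Yorke_chaotic_def)
    obtain a where a: "a \<in> S"
      using S(1) by fastforce
    have "\<not> S \<subseteq> {a}"
      using S(1) countable_subset by blast
    with S(2) a show ?pair
      by (auto simp: mean_Li_Yorke_scrambled_def)
  qed
  moreover have "?irr \<Longrightarrow> ?semi"
    using abs_mean_irregular_imp_semi by blast
  moreover have "?semi \<Longrightarrow> ?res"
  proof -
    assume ?semi
    then obtain x where "abs_mean_semi_irregular T x"
      by blast
    from semi_irregular_imp_residual_irregular[OF assms(3,4) this]
    obtain r where "invariant_under T (closure (null_along T r))"
      "residual_in (top_of_set (closure (null_along T r)))
        {y \<in> closure (null_along T r). abs_mean_irregular T y}"
      by blast
    moreover have "subspace (closure (null_along T r))"
      by (rule subspace_closure_null_along) (rule assms(2))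
    ultimately show ?res
      by blast
  qed
  moreover have "?res \<Longrightarrow> ?irr"
  proof -
    assume ?res
    then obtain X0 R where X0: "subspace X0" and R: "residual_in (top_of_set X0) R"
      and irr: "\<And>x. x \<in> R \<Longrightarrow> abs_mean_irregular T x"
      by blast
    \<comment> \<open>Since \<open>0\<close> lies in \<open>X0\<close>, the empty set is not dense
      there, so a residual set has a point.\<close>
    have "X0 \<noteq> {}"
      using subspace_0[OF X0] by blast
    with R have "R \<noteq> {}"
      by (auto simp: residual_in_def)
    with irr show ?irr
      by blast
  qed
  ultimately show ?thesis
    by blast
qed

end
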